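(* Assume that the perceived waiting/idle time functions of followers are quadratic, i.e. $\Psi_i=\Psi_i^q$ for all $i\in\mathcal I$ and $\Phi_{mn}=\Phi_{mn}^q$ for all $(m,n)\in\mathcal{MN}$. Let SLMFG-Q be the bilevel problem and MPEC-Q its KKT-based single-level reformulation, both defined in the context. a) If $(p,q,l,u,w,\Delta,x,y)$ is a global solution of SLMFG-Q, then for every $(\lambda,\mu)\in\Lambda(p,q,l,u,w,\Delta,x,y)$, the point $(p,q,l,u,w,\Delta,x,y,\lambda,\mu)$ is a global solution of MPEC-Q. b) Assume additionally that (i) $b_i\ge p_{\min}$ for every traveler $i\in\mathcal I$, and (ii) $\beta_{mn}\le q_{\max}$ for every $m\in\mathcal M$, $n\in\mathcal N_m$. If $(p,q,l,u,w,\Delta,x,y,\lambda,\mu)$ is a global solution of MPEC-Q, then $(p,q,l,u,w,\Delta,x,y)$ is a global solution of SLMFG-Q.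
   Context: Data. $\mathcal I$ is a finite set of travelers, $\mathcal M$ a finite set of travel modes, $\mathcal N_m$ a finite set of transportation service providers (TSPs) of mode $m$, $\mathcal{MN}=\{(m,n): m\in\mathcal M, n\in\mathcal N_m\}$. Real parameters: for $i\in\mathcal I$: $D_i,T_i,\alpha_i>0$, $Q_i=D_i^2/T_i$, and $b_i,r_i,B_i,R_i,\Gamma_i\ge 0$; for $(m,n)\in\mathcal{MN}$: $C_{mn},\eta_{mn}>0$ and $\beta_{mn},\gamma_{mn},\rho_{mn},\bar B_{mn}\ge 0$; for $m\in\mathcal M$: $v_m>0$, $\sigma_m\ge0$; bounds $p_{\min}\le p_{\max}$, $q_{\min}\le q_{\max}$ (nonnegative), $\overline C=\sum_{m\in\mathcal M}\sum_{n\in\mathcal N_m}C_{mn}$ and $0\le\underline C\le\overline C$; and $\zeta,\kappa,\vartheta,\xi>0$. Quadratic perceived time functions: $\Psi_i^q(x_i,\Delta)=\frac{\zeta}{\overline C^2}(\Delta+Q_ix_i)^2-\frac{2\zeta}{\overline C}(\Delta+Q_ix_i)+\vartheta$, $\Phi_{mn}^q(y_{mn},\Delta)=\frac{\kappa}{\overline C^2}(\Delta-C_{mn}y_{mn})^2+\xi$. Leader variables: $p,q,\Delta\in\mathbb R$, $l=(l_i^m)_{i\in\mathcal I,m\in\mathcal M}$, $u=(u_i)_{i\in\mathcal I}$, $w=(w_{mn})_{(m,n)\in\mathcal{MN}}$. Follower variables: $x=(x_i)_{i\in\mathcal I}$, $y=(y_{mn})_{(m,n)\in\mathcal{MN}}$.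 Leader objective (to be maximized): $F=\sum_{i\in\mathcal I}b_iQ_ix_i-\sum_{(m,n)\in\mathcal{MN}}\beta_{mn}C_{mn}y_{mn}$. Leader constraints: for all $i\in\mathcal I$: $\sum_m v_ml_i^m=D_ix_i$; $0\le\sum_m l_i^m-T_ix_i\le R_i$; $\sum_m\sigma_ml_i^m\le\Gamma_i$; $b_i-p\ge(1-u_i)(b_i-p_{\max})$; $b_i-p\le u_i(b_i-p_{\min})$; $u_i\in\{0,1\}$; $l_i^m\ge0$ for all $m$. For all $m\in\mathcal M$: $\sum_i v_m^2l_i^m\le\sum_{n\in\mathcal N_m}C_{mn}y_{mn}$. For all $(m,n)\in\mathcal{MN}$: $q-\beta_{mn}\ge(1-w_{mn})(q_{\min}-\beta_{mn})$; $q-\beta_{mn}\le w_{mn}(q_{\max}-\beta_{mn})$; $w_{mn}\in\{0,1\}$. Also $\Delta=\sum_{(m,n)}C_{mn}y_{mn}-\sum_iQ_ix_i$; $p_{\min}\le p\le p_{\max}$; $q_{\min}\le q\le q_{\max}$; $\underline C\le\Delta\le\overline C$. Follower problems (the leader variables $u_i,w_{mn},\Delta$ are treated as fixed parameters). Traveler $i$: minimize over $\hat x_i\in\mathcal S_i(u_i)=\{\hat x_i\in\mathbb R: b_iQ_i\hat x_i\le B_i,\ \hat x_i\le u_i,\ \hat x_i\ge0\}$ the function $G_i(\hat x_i,\Delta)=b_iQ_i\hat x_i+r_iQ_i(1-\hat x_i)+\alpha_i\Psi_i(\hat x_i,\Delta)$. TSP $mn$: maximize over $\hat y_{mn}\in\mathcal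 S_{mn}(w_{mn})=\{\hat y_{mn}\in\mathbb R: C_{mn}\gamma_{mn}\hat y_{mn}\le\bar B_{mn},\ \hat y_{mn}\le w_{mn},\ \hat y_{mn}\ge0\}$ the function $H_{mn}(\hat y_{mn},\Delta)=(\beta_{mn}-\gamma_{mn})C_{mn}\hat y_{mn}+(\rho_{mn}-\gamma_{mn})C_{mn}(1-\hat y_{mn})-\eta_{mn}\Phi_{mn}(\hat y_{mn},\Delta)$. SLMFG-Q (optimistic form): maximize $F$ over all $(p,q,l,u,w,\Delta,x,y)$ satisfying the leader constraints and such that, with $\Psi_i=\Psi_i^q$, $\Phi_{mn}=\Phi_{mn}^q$, $x_i$ is an optimal solution of traveler $i$'s problem for each $i$ and $y_{mn}$ is an optimal solution of TSP $mn$'s problem for each $(m,n)$. KKT conditions. Multipliers $\lambda=(\lambda_1^i,\lambda_2^i,\lambda_3^i)_{i\in\mathcal I}$, $\mu=(\mu_1^{mn},\mu_2^{mn},\mu_3^{mn})_{(m,n)\in\mathcal{MN}}$; $0\le a\perp b\ge0$ means $a,b\ge0$ and $ab=0$. Traveler $i$: $0\le B_i-b_iQ_ix_i\perp\lambda_1^i\ge0$, $0\le u_i-x_i\perp\lambda_2^i\ge0$, $0\le x_i\perp\lambda_3^i\ge0$, and $\frac{2\zeta\alpha_iQ_i^2}{\overline C^2}x_i-\left(\frac{2\zeta\alpha_i}{\overline C}-\frac{2\zeta\alpha_i\Delta}{\overline C^2}+r_i-b_i\right)Q_i+\lambda_1^ib_iQ_i+\lambda_2^i-\lambda_3^i=0$.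 TSP $mn$: $0\le\bar B_{mn}-C_{mn}\gamma_{mn}y_{mn}\perp\mu_1^{mn}\ge0$, $0\le w_{mn}-y_{mn}\perp\mu_2^{mn}\ge0$, $0\le y_{mn}\perp\mu_3^{mn}\ge0$, and $\frac{2\kappa\eta_{mn}C_{mn}^2}{\overline C^2}y_{mn}-\left(\frac{2\kappa\eta_{mn}\Delta}{\overline C^2}+\beta_{mn}-\rho_{mn}\right)C_{mn}+\mu_1^{mn}C_{mn}\gamma_{mn}+\mu_2^{mn}-\mu_3^{mn}=0$. $\Lambda(p,q,l,u,w,\Delta,x,y)$ is the set of all $(\lambda,\mu)$ for which the KKT conditions of all travelers and all TSPs hold at that point. MPEC-Q: maximize $F$ over all $(p,q,l,u,w,\Delta,x,y,\lambda,\mu)$ satisfying the leader constraints and the KKT conditions of all travelers and TSPs. A global solution of a maximization problem is a feasible point whose objective value is at least that of every feasible point. *)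

theory Defs
  imports Complex_Main
begin

text \<open>
  Travelers, modes and providers are finite carrier sets; a provider is indexed by a pair
  \<open>(m, n)\<close>.  All families are total functions, of which only the values on the carriers matter.
  \<open>psi\<close>, \<open>phi\<close> are kept as arguments in the general bilevel problem and are
  instantiated by their quadratic versions in the problem SLMFG-Q.
\<close>

record ('i, 'm, 'n) slmfg_data =
  travelers :: "'i set"
  modes :: "'m set"
  tsps :: "'m \<Rightarrow> 'n set"
  par_D :: "'i \<Rightarrow> real"
  par_T :: "'i \<Rightarrow> real"
  par_alpha :: "'i \<Rightarrow> real"
  par_b :: "'i \<Rightarrow> real"
  par_r :: "'i \<Rightarrow> real"
  par_B :: "'i \<Rightarrow> real"
  par_R :: "'i \<Rightarrow> real"
  par_Gamma :: "'i \<Rightarrow> real"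
  par_C :: "'m \<times> 'n \<Rightarrow> real"
  par_eta :: "'m \<times> 'n \<Rightarrow> real"
  par_beta :: "'m \<times> 'n \<Rightarrow> real"
  par_gamma :: "'m \<times> 'n \<Rightarrow> real"
  par_rho :: "'m \<times> 'n \<Rightarrow> real"
  par_Bbar :: "'m \<times> 'n \<Rightarrow> real"
  par_v :: "'m \<Rightarrow> real"
  par_sigma :: "'m \<Rightarrow> real"
  p_min :: real
  p_max :: real
  q_min :: real
  q_max :: real
  C_low :: real
  par_zeta :: real
  par_kappa :: real
  par_theta :: real
  par_xi :: real

definition MN :: "('i, 'm, 'n) slmfg_data \<Rightarrow> ('m \<times> 'n) set" where
  "MN d = (SIGMA m:modes d. tsps d m)"

definition par_Q :: "('i, 'm, 'n) slmfg_data \<Rightarrow> 'i \<Rightarrow> real" where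
  "par_Q d i = (par_D d i)\<^sup>2 / par_T d i"

definition C_up :: "('i, 'm, 'n) slmfg_data \<Rightarrow> real" where
  "C_up d = (\<Sum>m\<in>modes d. \<Sum>n\<in>tsps d m. par_C d (m, n))"

text \<open>
  The carriers may be empty.  If \<open>MN d\<close> is empty then \<open>C_up d = 0\<close>, and by
  \<open>x / 0 = 0\<close> the terms divided by \<open>C_up d\<close> vanish, both in the perceived
  time functions and in the KKT conditions.
\<close>

definition valid_data :: "('i, 'm, 'n) slmfg_data \<Rightarrow> bool" where
  "valid_data d \<longleftrightarrow>
     finite (travelers d) \<and> finite (modes d) \<and> (\<forall>m\<in>modes d. finite (tsps d m)) \<and>
     (\<forall>i\<in>travelers d.
        par_D d i > 0 \<and> par_T d i > 0 \<and> par_alpha d i > 0 \<and>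
        par_b d i \<ge> 0 \<and> par_r d i \<ge> 0 \<and> par_B d i \<ge> 0 \<and> par_R d i \<ge> 0 \<and> par_Gamma d i \<ge> 0) \<and>
     (\<forall>k\<in>MN d.
        par_C d k > 0 \<and> par_eta d k > 0 \<and>
        par_beta d k \<ge> 0 \<and> par_gamma d k \<ge> 0 \<and> par_rho d k \<ge> 0 \<and> par_Bbar d k \<ge> 0) \<and>
     (\<forall>m\<in>modes d. par_v d m > 0 \<and> par_sigma d m \<ge> 0) \<and>
     0 \<le> p_min d \<and> p_min d \<le> p_max d \<and>
     0 \<le> q_min d \<and> q_min d \<le> q_max d \<and>
     0 \<le> C_low d \<and> C_low d \<le> C_up d \<and>
     par_zeta d > 0 \<and> par_kappa d > 0 \<and> par_theta d > 0 \<and> par_xi d > 0"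

definition psi_q :: "('i, 'm, 'n) slmfg_data \<Rightarrow> 'i \<Rightarrow> real \<Rightarrow> real \<Rightarrow> real" where
  "psi_q d i xi \<Delta> =
     par_zeta d / (C_up d)\<^sup>2 * (\<Delta> + par_Q d i * xi)\<^sup>2
     - 2 * par_zeta d / C_up d * (\<Delta> + par_Q d i * xi) + par_theta d"

definition phi_q :: "('i, 'm, 'n) slmfg_data \<Rightarrow> 'm \<times> 'n \<Rightarrow> real \<Rightarrow> real \<Rightarrow> real" where
  "phi_q d k yk \<Delta> =
     par_kappa d / (C_up d)\<^sup>2 * (\<Delta> - par_C d k * yk)\<^sup>2 + par_xi d"

record ('i, 'm, 'n) point =
  var_p :: real
  var_q :: real
  var_l :: "'i \<Rightarrow> 'm \<Rightarrow> real"
  var_u :: "'i \<Rightarrow> real"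
  var_w :: "'m \<times> 'n \<Rightarrow> real"
  var_Delta :: real
  var_x :: "'i \<Rightarrow> real"
  var_y :: "'m \<times> 'n \<Rightarrow> real"

record ('i, 'm, 'n) multipliers =
  lam1 :: "'i \<Rightarrow> real"
  lam2 :: "'i \<Rightarrow> real"
  lam3 :: "'i \<Rightarrow> real"
  mu1 :: "'m \<times> 'n \<Rightarrow> real"
  mu2 :: "'m \<times> 'n \<Rightarrow> real"
  mu3 :: "'m \<times> 'n \<Rightarrow> real"

definition leader_objective ::
    "('i, 'm, 'n) slmfg_data \<Rightarrow> ('i, 'm, 'n) point \<Rightarrow> real" where
  "leader_objective d z =
     (\<Sum>i\<in>travelers d. par_b d i * par_Q d i * var_x z i)
     - (\<Sum>k\<in>MN d. par_beta d k * par_C d k * var_y z k)"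

definition leader_traveler_constraints ::
    "('i, 'm, 'n) slmfg_data \<Rightarrow> ('i, 'm, 'n) point \<Rightarrow> 'i \<Rightarrow> bool" where
  "leader_traveler_constraints d z i \<longleftrightarrow>
     (\<Sum>m\<in>modes d. par_v d m * var_l z i m) = par_D d i * var_x z i \<and>
     0 \<le> (\<Sum>m\<in>modes d. var_l z i m) - par_T d i * var_x z i \<and>
     (\<Sum>m\<in>modes d. var_l z i m) - par_T d i * var_x z i \<le> par_R d i \<and>
     (\<Sum>m\<in>modes d. par_sigma d m * var_l z i m) \<le> par_Gamma d i \<and>
     par_b d i - var_p z \<ge> (1 - var_u z i) * (par_b d i - p_max d) \<and>
     par_b d i - var_p z \<le> var_u z i * (par_b d i - p_min d) \<and>
     var_u z i \<in> {0, 1} \<and>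
     (\<forall>m\<in>modes d. var_l z i m \<ge> 0)"

definition leader_tsp_constraints ::
    "('i, 'm, 'n) slmfg_data \<Rightarrow> ('i, 'm, 'n) point \<Rightarrow> 'm \<times> 'n \<Rightarrow> bool" where
  "leader_tsp_constraints d z k \<longleftrightarrow>
     var_q z - par_beta d k \<ge> (1 - var_w z k) * (q_min d - par_beta d k) \<and>
     var_q z - par_beta d k \<le> var_w z k * (q_max d - par_beta d k) \<and>
     var_w z k \<in> {0, 1}"

definition leader_constraints ::
    "('i, 'm, 'n) slmfg_data \<Rightarrow> ('i, 'm, 'n) point \<Rightarrow> bool" where
  "leader_constraints d z \<longleftrightarrow>
     (\<forall>i\<in>travelers d. leader_traveler_constraints d z i) \<and>
     (\<forall>m\<in>modes d. (\<Sum>i\<in>travelers d. (par_v d m)\<^sup>2 * var_l z i m)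
                    \<le> (\<Sum>n\<in>tsps d m. par_C d (m, n) * var_y z (m, n))) \<and>
     (\<forall>k\<in>MN d. leader_tsp_constraints d z k) \<and>
     var_Delta z = (\<Sum>k\<in>MN d. par_C d k * var_y z k)
                   - (\<Sum>i\<in>travelers d. par_Q d i * var_x z i) \<and>
     p_min d \<le> var_p z \<and> var_p z \<le> p_max d \<and>
     q_min d \<le> var_q z \<and> var_q z \<le> q_max d \<and>
     C_low d \<le> var_Delta z \<and> var_Delta z \<le> C_up d"

definition traveler_set :: "('i, 'm, 'n) slmfg_data \<Rightarrow> 'i \<Rightarrow> real \<Rightarrow> real set" where
  "traveler_set d i ui = {xi. par_b d i * par_Q d i * xi \<le> par_B d i \<and> xi \<le> ui \<and> xi \<ge> 0}"

definition traveler_cost ::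
    "('i, 'm, 'n) slmfg_data \<Rightarrow> ('i \<Rightarrow> real \<Rightarrow> real \<Rightarrow> real) \<Rightarrow> 'i \<Rightarrow> real \<Rightarrow> real \<Rightarrow> real" where
  "traveler_cost d psi i xi \<Delta> =
     par_b d i * par_Q d i * xi + par_r d i * par_Q d i * (1 - xi) + par_alpha d i * psi i xi \<Delta>"

definition tsp_set :: "('i, 'm, 'n) slmfg_data \<Rightarrow> 'm \<times> 'n \<Rightarrow> real \<Rightarrow> real set" where
  "tsp_set d k wk = {yk. par_C d k * par_gamma d k * yk \<le> par_Bbar d k \<and> yk \<le> wk \<and> yk \<ge> 0}"

definition tsp_profit ::
    "('i, 'm, 'n) slmfg_data \<Rightarrow> ('m \<times> 'n \<Rightarrow> real \<Rightarrow> real \<Rightarrow> real) \<Rightarrow> 'm \<times> 'n \<Rightarrow> real \<Rightarrow> real \<Rightarrow> real" where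
  "tsp_profit d phi k yk \<Delta> =
     (par_beta d k - par_gamma d k) * par_C d k * yk
     + (par_rho d k - par_gamma d k) * par_C d k * (1 - yk) - par_eta d k * phi k yk \<Delta>"

definition slmfg_feasible ::
    "('i, 'm, 'n) slmfg_data \<Rightarrow> ('i \<Rightarrow> real \<Rightarrow> real \<Rightarrow> real) \<Rightarrow> ('m \<times> 'n \<Rightarrow> real \<Rightarrow> real \<Rightarrow> real)
      \<Rightarrow> ('i, 'm, 'n) point \<Rightarrow> bool" where
  "slmfg_feasible d psi phi z \<longleftrightarrow>
     leader_constraints d z \<and>
     (\<forall>i\<in>travelers d.
        is_arg_min (\<lambda>xi. traveler_cost d psi i xi (var_Delta z))
          (\<lambda>xi. xi \<in> traveler_set d i (var_u z i)) (var_x z i)) \<and>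
     (\<forall>k\<in>MN d.
        is_arg_max (\<lambda>yk. tsp_profit d phi k yk (var_Delta z))
          (\<lambda>yk. yk \<in> tsp_set d k (var_w z k)) (var_y z k))"

definition slmfg_q_global_solution ::
    "('i, 'm, 'n) slmfg_data \<Rightarrow> ('i, 'm, 'n) point \<Rightarrow> bool" where
  "slmfg_q_global_solution d z \<longleftrightarrow>
     is_arg_max (leader_objective d) (slmfg_feasible d (psi_q d) (phi_q d)) z"

definition complementary :: "real \<Rightarrow> real \<Rightarrow> bool" where
  "complementary a b \<longleftrightarrow> 0 \<le> a \<and> 0 \<le> b \<and> a * b = 0"

definition traveler_kkt ::
    "('i, 'm, 'n) slmfg_data \<Rightarrow> ('i, 'm, 'n) point \<Rightarrow> ('i, 'm, 'n) multipliers \<Rightarrow> 'i \<Rightarrow> bool" where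
  "traveler_kkt d z \<nu> i \<longleftrightarrow>
     complementary (par_B d i - par_b d i * par_Q d i * var_x z i) (lam1 \<nu> i) \<and>
     complementary (var_u z i - var_x z i) (lam2 \<nu> i) \<and>
     complementary (var_x z i) (lam3 \<nu> i) \<and>
     2 * par_zeta d * par_alpha d i * (par_Q d i)\<^sup>2 / (C_up d)\<^sup>2 * var_x z i
     - (2 * par_zeta d * par_alpha d i / C_up d
        - 2 * par_zeta d * par_alpha d i * var_Delta z / (C_up d)\<^sup>2
        + par_r d i - par_b d i) * par_Q d i
     + lam1 \<nu> i * par_b d i * par_Q d i + lam2 \<nu> i - lam3 \<nu> i = 0"

definition tsp_kkt ::
    "('i, 'm, 'n) slmfg_data \<Rightarrow> ('i, 'm, 'n) point \<Rightarrow> ('i, 'm, 'n) multipliers \<Rightarrow> 'm \<times> 'n \<Rightarrow> bool" where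
  "tsp_kkt d z \<nu> k \<longleftrightarrow>
     complementary (par_Bbar d k - par_C d k * par_gamma d k * var_y z k) (mu1 \<nu> k) \<and>
     complementary (var_w z k - var_y z k) (mu2 \<nu> k) \<and>
     complementary (var_y z k) (mu3 \<nu> k) \<and>
     2 * par_kappa d * par_eta d k * (par_C d k)\<^sup>2 / (C_up d)\<^sup>2 * var_y z k
     - (2 * par_kappa d * par_eta d k * var_Delta z / (C_up d)\<^sup>2
        + par_beta d k - par_rho d k) * par_C d k
     + mu1 \<nu> k * par_C d k * par_gamma d k + mu2 \<nu> k - mu3 \<nu> k = 0"

definition kkt_multipliers ::
    "('i, 'm, 'n) slmfg_data \<Rightarrow> ('i, 'm, 'n) point \<Rightarrow> ('i, 'm, 'n) multipliers set" where
  "kkt_multipliers d z =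
     {\<nu>. (\<forall>i\<in>travelers d. traveler_kkt d z \<nu> i) \<and> (\<forall>k\<in>MN d. tsp_kkt d z \<nu> k)}"

definition mpec_q_feasible ::
    "('i, 'm, 'n) slmfg_data \<Rightarrow> ('i, 'm, 'n) point \<times> ('i, 'm, 'n) multipliers \<Rightarrow> bool" where
  "mpec_q_feasible d = (\<lambda>(z, \<nu>). leader_constraints d z \<and> \<nu> \<in> kkt_multipliers d z)"

definition mpec_q_global_solution ::
    "('i, 'm, 'n) slmfg_data \<Rightarrow> ('i, 'm, 'n) point \<times> ('i, 'm, 'n) multipliers \<Rightarrow> bool" where
  "mpec_q_global_solution d =
     is_arg_max (\<lambda>(z, \<nu>). leader_objective d z) (mpec_q_feasible d)"

end

theory Submission
  imports Defs
begin

text \<open>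
  Once the leader variables are fixed, each follower minimises a convex quadratic in one real
  variable over an interval cut out by three affine inequalities.  For such a problem the KKT
  conditions characterise the minimisers exactly.  Convexity makes them sufficient.  They are
  necessary because the constraints are affine: in one dimension a nonzero slope at the minimiser forces a constraint blocking
  the descent direction to be active, and that constraint alone can carry the multiplier.
  This is \<open>quadratic_minimizer_iff_kkt\<close>, obtained by passing
  through the variational inequality \<open>f' x * (t - x) \<ge> 0\<close>; a provider's maximisation is
  reduced to it by changing sign.

  The multipliers of different followers are independent of one another, so they can be collected
  into one family.  Hence a point is feasible for the bilevel problem if and only if it satisfies
  the leader constraints and carries some KKT multiplier (\<open>slmfg_feasible_iff_kkt\<close>).
  In other words, the feasible set of the bilevel problem is the projection of the feasible set of
  the single-level problem along the multipliers.  The objective does not depend on the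
  multipliers, so both problems have the same optimal value, and global solutions can be carried
  over in either direction.
\<close>

section \<open>Convex quadratic minimisation on an interval\<close>

text \<open>
  The quadratic Taylor expansion at \<open>x\<close> is exact, which gives one direction for \<open>a \<ge> 0\<close>.  For the
  other, stepping from \<open>x\<close> a small fraction \<open>\<epsilon>\<close> of the way towards \<open>t\<close> stays in the convex set and
  changes the function by \<open>\<epsilon> * f' x * (t - x)\<close> up to a term of order \<open>\<epsilon>\<^sup>2\<close>.
\<close>

lemma quadratic_minimizer_iff_variational_inequality:
  fixes a c e x :: real and S :: "real set"
  assumes a: "0 \<le> a"
    and segment: "\<And>s t \<epsilon>. s \<in> S \<Longrightarrow> t \<in> S \<Longrightarrow> 0 \<le> \<epsilon> \<Longrightarrow> \<epsilon> \<le> 1 \<Longrightarrow> s + \<epsilon> * (t - s) \<in> S"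
  shows "is_arg_min (\<lambda>t. a * t\<^sup>2 + c * t + e) (\<lambda>t. t \<in> S) x
         \<longleftrightarrow> x \<in> S \<and> (\<forall>t\<in>S. (2 * a * x + c) * (t - x) \<ge> 0)"
proof -
  define f where "f = (\<lambda>t. a * t\<^sup>2 + c * t + e)"
  define g where "g = 2 * a * x + c"
  have taylor: "f t = f x + g * (t - x) + a * (t - x)\<^sup>2" for t
    unfolding f_def g_def by (simp add: power2_eq_square algebra_simps)
  have "g * (t - x) \<ge> 0" if x: "x \<in> S" and least: "\<forall>t\<in>S. f x \<le> f t" and t: "t \<in> S" for t
  proof (rule ccontr)
    assume "\<not> g * (t - x) \<ge> 0"
    then have G: "- (g * (t - x)) > 0" by simp
    define A where "A = a * (t - x)\<^sup>2"
    have A: "A \<ge> 0" unfolding A_def using a by simp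
    \<comment> \<open>Any fraction in \<open>(0, 1]\<close> with \<open>\<epsilon> * A < - (g * (t - x))\<close> yields a strictly smaller value.\<close>
    define \<epsilon> where "\<epsilon> = - (g * (t - x)) / (A - g * (t - x))"
    have eps: "0 < \<epsilon>" "\<epsilon> \<le> 1" unfolding \<epsilon>_def using G A by (simp_all add: divide_simps)
    have "\<epsilon> * (A - g * (t - x)) = - (g * (t - x))"
      unfolding \<epsilon>_def using G A by simp
    moreover have "\<epsilon> * A \<ge> 0" "\<epsilon> * - (g * (t - x)) > 0"
      using eps A mult_pos_pos[OF eps(1) G] by simp_all
    ultimately have small: "g * (t - x) + \<epsilon> * A < 0"
      by (simp add: algebra_simps)
    have "f (x + \<epsilon> * (t - x)) = f x + \<epsilon> * (g * (t - x) + \<epsilon> * A)"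
      unfolding taylor[of "x + \<epsilon> * (t - x)"] A_def by (simp add: power2_eq_square algebra_simps)
    also have "\<dots> < f x" using mult_pos_neg[OF eps(1) small] by simp
    finally show False using least segment[OF x t, of \<epsilon>] eps by (simp add: not_le[symmetric])
  qed
  moreover have "f x \<le> f t" if "g * (t - x) \<ge> 0" for t
    using that a taylor[of t] by simp
  ultimately show ?thesis
    unfolding is_arg_min_def f_def[symmetric] g_def[symmetric] by (auto simp: not_less)
qed

text \<open>
  A positive slope can only be blocked on the left, by \<open>0 \<le> x\<close>; a negative one on the right, by
  \<open>x \<le> u\<close> or by \<open>s * x \<le> B\<close> with \<open>s > 0\<close>.  In each case one multiplier absorbs the whole slope and
  the other two vanish.  Conversely, complementary slackness turns the contribution of
  each multiplier to \<open>g * (t - x)\<close> into that multiplier times the slack of its constraint at \<open>t\<close>.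
\<close>

lemma variational_inequality_iff_multipliers:
  fixes g s B u x :: real
  assumes s: "0 \<le> s"
  defines "S \<equiv> {t. s * t \<le> B \<and> t \<le> u \<and> t \<ge> 0}"
  shows "x \<in> S \<and> (\<forall>t\<in>S. g * (t - x) \<ge> 0)
         \<longleftrightarrow> (\<exists>l1 l2 l3. complementary (B - s * x) l1 \<and> complementary (u - x) l2 \<and>
                complementary x l3 \<and> g + l1 * s + l2 - l3 = 0)"
proof
  assume L: "x \<in> S \<and> (\<forall>t\<in>S. g * (t - x) \<ge> 0)"
  then have x: "s * x \<le> B" "x \<le> u" "x \<ge> 0" and vi: "\<And>t. t \<in> S \<Longrightarrow> g * (t - x) \<ge> 0"
    unfolding S_def by auto
  consider "g \<ge> 0" | "g < 0" "x = u" | "g < 0" "s > 0" "s * x = B"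
    | "g < 0" "x < u" "s = 0 \<or> s * x < B"
    using x s by linarith
  then show "\<exists>l1 l2 l3. complementary (B - s * x) l1 \<and> complementary (u - x) l2 \<and>
                complementary x l3 \<and> g + l1 * s + l2 - l3 = 0"
  proof cases
    case 1
    have "0 \<in> S" unfolding S_def using x mult_nonneg_nonneg[OF s x(3)] by simp
    then have "g * x \<le> 0" using vi[of 0] by simp
    then have "x * g = 0" using mult_nonneg_nonneg[OF 1 x(3)] by (simp add: mult.commute)
    then show ?thesis
      using 1 x by - (rule exI[of _ 0], rule exI[of _ 0], rule exI[of _ g],
          auto simp: complementary_def)
  next
    case 2
    then show ?thesis
      using x by - (rule exI[of _ 0], rule exI[of _ "- g"], rule exI[of _ 0],
          auto simp: complementary_def)
  next
    case 3
    then show ?thesis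
      using x by - (rule exI[of _ "- g / s"], rule exI[of _ 0], rule exI[of _ 0],
          auto simp: complementary_def divide_nonpos_pos)
  next
    case 4
    \<comment> \<open>No constraint blocks the move to the right, so the right end of the interval lies beyond \<open>x\<close>.\<close>
    define t where "t = (if s = 0 then u else min u (B / s))"
    have "0 \<le> B" using mult_nonneg_nonneg[OF s x(3)] x(1) by linarith
    then have "t > x" "t \<in> S"
      using 4 x s unfolding S_def t_def by (auto simp: min_def field_simps)
    then show ?thesis using vi[of t] 4 mult_neg_pos[of g "t - x"] by linarith
  qed
next
  assume "\<exists>l1 l2 l3. complementary (B - s * x) l1 \<and> complementary (u - x) l2 \<and>
                complementary x l3 \<and> g + l1 * s + l2 - l3 = 0"
  then obtain l1 l2 l3 where k: "complementary (B - s * x) l1" "complementary (u - x) l2"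
    "complementary x l3" and st: "g + l1 * s + l2 - l3 = 0" by blast
  have "g * (t - x) \<ge> 0" if "t \<in> S" for t
  proof -
    have g: "g = l3 - l1 * s - l2" using st by simp
    have "g * (t - x) = l1 * (B - s * t) + l2 * (u - t) + l3 * t
          - (B - s * x) * l1 - (u - x) * l2 - x * l3"
      unfolding g by (simp add: algebra_simps)
    also have "\<dots> = l1 * (B - s * t) + l2 * (u - t) + l3 * t"
      using k unfolding complementary_def by linarith
    also have "\<dots> \<ge> 0"
      using k that unfolding S_def complementary_def by simp
    finally show ?thesis .
  qed
  then show "x \<in> S \<and> (\<forall>t\<in>S. g * (t - x) \<ge> 0)"
    using k unfolding S_def complementary_def by simp
qed

lemma quadratic_minimizer_iff_kkt:
  fixes a c e s B u x :: real
  assumes a: "0 \<le> a" and s: "0 \<le> s"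
  shows "is_arg_min (\<lambda>t. a * t\<^sup>2 + c * t + e) (\<lambda>t. t \<in> {t. s * t \<le> B \<and> t \<le> u \<and> t \<ge> 0}) x
         \<longleftrightarrow> (\<exists>l1 l2 l3. complementary (B - s * x) l1 \<and> complementary (u - x) l2 \<and>
                complementary x l3 \<and> 2 * a * x + c + l1 * s + l2 - l3 = 0)"
proof -
  have segment: "r + \<epsilon> * (t - r) \<in> {t. s * t \<le> B \<and> t \<le> u \<and> t \<ge> 0}"
    if "r \<in> {t. s * t \<le> B \<and> t \<le> u \<and> t \<ge> 0}" "t \<in> {t. s * t \<le> B \<and> t \<le> u \<and> t \<ge> 0}"
      "0 \<le> \<epsilon>" "\<epsilon> \<le> 1" for r t \<epsilon> :: real
  proof -
    have "r + \<epsilon> * (t - r) = (1 - \<epsilon>) * r + \<epsilon> * t"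
      "s * (r + \<epsilon> * (t - r)) = (1 - \<epsilon>) * (s * r) + \<epsilon> * (s * t)"
      by (simp_all add: algebra_simps)
    moreover have "(1 - \<epsilon>) * r + \<epsilon> * t \<le> u" "(1 - \<epsilon>) * (s * r) + \<epsilon> * (s * t) \<le> B"
      "0 \<le> (1 - \<epsilon>) * r + \<epsilon> * t"
      using that by (auto intro!: convex_bound_le)
    ultimately show ?thesis by simp
  qed
  show ?thesis
    by (rule trans[OF quadratic_minimizer_iff_variational_inequality[OF a segment]
          variational_inequality_iff_multipliers[OF s]])
qed

section \<open>The followers' problems\<close>

text \<open>
  With the quadratic perceived time, the cost is \<open>a * t\<^sup>2 + c * t + e\<close> with \<open>a \<ge> 0\<close>, and
  \<open>2 * a * x + c\<close> is the multiplier-free part of the stationarity condition.  The inverse of the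
  total capacity is kept as a single factor, so the case \<open>C_up d = 0\<close> is included.
\<close>

lemma traveler_optimal_iff_kkt:
  assumes d: "valid_data d" and i: "i \<in> travelers d"
  shows "is_arg_min (\<lambda>t. traveler_cost d (psi_q d) i t (var_Delta z))
           (\<lambda>t. t \<in> traveler_set d i (var_u z i)) (var_x z i)
         \<longleftrightarrow> (\<exists>\<nu>. traveler_kkt d z \<nu> i)"
    (is "?opt \<longleftrightarrow> ?kkt")
proof -
  have pos: "par_D d i > 0" "par_T d i > 0" "par_alpha d i > 0" "par_b d i \<ge> 0" "par_zeta d > 0"
    using d i by (auto simp: valid_data_def)
  define k where "k = inverse (C_up d)"
  define Q where "Q = par_Q d i"
  define a where "a = par_alpha d i * par_zeta d * k\<^sup>2 * Q\<^sup>2"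
  define c where "c = (par_b d i - par_r d i
    + 2 * par_alpha d i * par_zeta d * (k\<^sup>2 * var_Delta z - k)) * Q"
  define e where "e = par_r d i * Q + par_alpha d i *
    (par_zeta d * k\<^sup>2 * (var_Delta z)\<^sup>2 - 2 * par_zeta d * k * var_Delta z + par_theta d)"
  have a: "a \<ge> 0" unfolding a_def using pos by simp
  have s: "par_b d i * Q \<ge> 0" unfolding Q_def par_Q_def using pos by simp
  have cost: "(\<lambda>t. traveler_cost d (psi_q d) i t (var_Delta z)) = (\<lambda>t. a * t\<^sup>2 + c * t + e)"
    unfolding traveler_cost_def psi_q_def a_def c_def e_def k_def Q_def
    by (rule ext) (simp add: divide_inverse power2_eq_square algebra_simps)
  have slope: "2 * par_zeta d * par_alpha d i * Q\<^sup>2 / (C_up d)\<^sup>2 * var_x z i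
     - (2 * par_zeta d * par_alpha d i / C_up d
        - 2 * par_zeta d * par_alpha d i * var_Delta z / (C_up d)\<^sup>2
        + par_r d i - par_b d i) * Q = 2 * a * var_x z i + c"
    unfolding a_def c_def k_def
    by (simp add: divide_inverse power2_eq_square algebra_simps)
  have "?opt \<longleftrightarrow> (\<exists>l1 l2 l3. complementary (par_B d i - par_b d i * Q * var_x z i) l1 \<and>
      complementary (var_u z i - var_x z i) l2 \<and> complementary (var_x z i) l3 \<and>
      2 * a * var_x z i + c + l1 * (par_b d i * Q) + l2 - l3 = 0)"
    unfolding cost traveler_set_def Q_def[symmetric] by (rule quadratic_minimizer_iff_kkt[OF a s])
  \<comment> \<open>Only the values at \<open>i\<close> of the multiplier families enter the condition, so scalars suffice.\<close>
  also have "\<dots> \<longleftrightarrow> ?kkt" (is "?scalar \<longleftrightarrow> _")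
  proof
    assume ?scalar
    then obtain l1 l2 l3 where
      "complementary (par_B d i - par_b d i * Q * var_x z i) l1 \<and>
       complementary (var_u z i - var_x z i) l2 \<and> complementary (var_x z i) l3 \<and>
       2 * a * var_x z i + c + l1 * (par_b d i * Q) + l2 - l3 = 0" by blast
    then have "traveler_kkt d z \<lparr>lam1 = \<lambda>_. l1, lam2 = \<lambda>_. l2, lam3 = \<lambda>_. l3,
        mu1 = \<lambda>_. 0, mu2 = \<lambda>_. 0, mu3 = \<lambda>_. 0\<rparr> i"
      unfolding traveler_kkt_def Q_def[symmetric] slope by (simp add: mult.assoc)
    then show ?kkt by blast
  next
    assume ?kkt
    then show ?scalar
      unfolding traveler_kkt_def Q_def[symmetric] slope by (metis mult.assoc)
  qed
  finally show ?thesis .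
qed

text \<open>
  The negated profit is again a convex quadratic, and its derivative is the multiplier-free part of
  the provider's stationarity condition.
\<close>

lemma tsp_optimal_iff_kkt:
  assumes d: "valid_data d" and j: "j \<in> MN d"
  shows "is_arg_max (\<lambda>t. tsp_profit d (phi_q d) j t (var_Delta z))
           (\<lambda>t. t \<in> tsp_set d j (var_w z j)) (var_y z j)
         \<longleftrightarrow> (\<exists>\<nu>. tsp_kkt d z \<nu> j)"
    (is "?opt \<longleftrightarrow> ?kkt")
proof -
  have pos: "par_C d j > 0" "par_eta d j > 0" "par_gamma d j \<ge> 0" "par_kappa d > 0"
    using d j by (auto simp: valid_data_def)
  define k where "k = inverse (C_up d)"
  define C where "C = par_C d j"
  define a where "a = par_eta d j * par_kappa d * k\<^sup>2 * C\<^sup>2"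
  define c where "c = (par_rho d j - par_beta d j
    - 2 * par_eta d j * par_kappa d * k\<^sup>2 * var_Delta z) * C"
  define e where "e = (par_gamma d j - par_rho d j) * C
    + par_eta d j * (par_kappa d * k\<^sup>2 * (var_Delta z)\<^sup>2 + par_xi d)"
  have a: "a \<ge> 0" unfolding a_def using pos by simp
  have s: "C * par_gamma d j \<ge> 0" unfolding C_def using pos by simp
  have loss: "(\<lambda>t. - tsp_profit d (phi_q d) j t (var_Delta z)) = (\<lambda>t. a * t\<^sup>2 + c * t + e)"
    unfolding tsp_profit_def phi_q_def a_def c_def e_def k_def C_def
    by (rule ext) (simp add: divide_inverse power2_eq_square algebra_simps)
  have slope: "2 * par_kappa d * par_eta d j * C\<^sup>2 / (C_up d)\<^sup>2 * var_y z j
     - (2 * par_kappa d * par_eta d j * var_Delta z / (C_up d)\<^sup>2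
        + par_beta d j - par_rho d j) * C = 2 * a * var_y z j + c"
    unfolding a_def c_def k_def
    by (simp add: divide_inverse power2_eq_square algebra_simps)
  have "?opt \<longleftrightarrow> is_arg_min (\<lambda>t. - tsp_profit d (phi_q d) j t (var_Delta z))
      (\<lambda>t. t \<in> tsp_set d j (var_w z j)) (var_y z j)"
    by (simp add: is_arg_max_def is_arg_min_def)
  also have "\<dots> \<longleftrightarrow> (\<exists>m1 m2 m3. complementary (par_Bbar d j - C * par_gamma d j * var_y z j) m1 \<and>
      complementary (var_w z j - var_y z j) m2 \<and> complementary (var_y z j) m3 \<and>
      2 * a * var_y z j + c + m1 * (C * par_gamma d j) + m2 - m3 = 0)"
    unfolding loss tsp_set_def C_def[symmetric] by (rule quadratic_minimizer_iff_kkt[OF a s])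
  also have "\<dots> \<longleftrightarrow> ?kkt" (is "?scalar \<longleftrightarrow> _")
  proof
    assume ?scalar
    then obtain m1 m2 m3 where
      "complementary (par_Bbar d j - C * par_gamma d j * var_y z j) m1 \<and>
       complementary (var_w z j - var_y z j) m2 \<and> complementary (var_y z j) m3 \<and>
       2 * a * var_y z j + c + m1 * (C * par_gamma d j) + m2 - m3 = 0" by blast
    then have "tsp_kkt d z \<lparr>lam1 = \<lambda>_. 0, lam2 = \<lambda>_. 0, lam3 = \<lambda>_. 0,
        mu1 = \<lambda>_. m1, mu2 = \<lambda>_. m2, mu3 = \<lambda>_. m3\<rparr> j"
      unfolding tsp_kkt_def C_def[symmetric] slope by (simp add: mult.assoc)
    then show ?kkt by blast
  next
    assume ?kkt
    then show ?scalar
      unfolding tsp_kkt_def C_def[symmetric] slope by (metis mult.assoc)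
  qed
  finally show ?thesis .
qed

section \<open>The bilevel problem as a projection of the single-level problem\<close>

text \<open>
  The condition of each follower reads the multiplier families only at its own index, so
  multipliers chosen separately for every follower combine along the diagonal.
\<close>

lemma kkt_multipliers_nonempty_iff:
  "kkt_multipliers d z \<noteq> {} \<longleftrightarrow>
     (\<forall>i\<in>travelers d. \<exists>\<nu>. traveler_kkt d z \<nu> i) \<and> (\<forall>k\<in>MN d. \<exists>\<nu>. tsp_kkt d z \<nu> k)"
proof
  assume "(\<forall>i\<in>travelers d. \<exists>\<nu>. traveler_kkt d z \<nu> i) \<and> (\<forall>k\<in>MN d. \<exists>\<nu>. tsp_kkt d z \<nu> k)"
  then obtain f g where f: "\<forall>i\<in>travelers d. traveler_kkt d z (f i) i"
    and g: "\<forall>k\<in>MN d. tsp_kkt d z (g k) k"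
    by metis
  define \<nu> where "\<nu> = \<lparr>lam1 = \<lambda>i. lam1 (f i) i, lam2 = \<lambda>i. lam2 (f i) i, lam3 = \<lambda>i. lam3 (f i) i,
    mu1 = \<lambda>k. mu1 (g k) k, mu2 = \<lambda>k. mu2 (g k) k, mu3 = \<lambda>k. mu3 (g k) k\<rparr>"
  have "\<nu> \<in> kkt_multipliers d z"
    using f g unfolding kkt_multipliers_def traveler_kkt_def tsp_kkt_def \<nu>_def by simp
  then show "kkt_multipliers d z \<noteq> {}" by blast
qed (auto simp: kkt_multipliers_def)

lemma slmfg_feasible_iff_kkt:
  assumes "valid_data d"
  shows "slmfg_feasible d (psi_q d) (phi_q d) z
         \<longleftrightarrow> leader_constraints d z \<and> kkt_multipliers d z \<noteq> {}"
  using assms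
  by (simp add: slmfg_feasible_def kkt_multipliers_nonempty_iff traveler_optimal_iff_kkt
      tsp_optimal_iff_kkt)

text \<open>
  Maximising over the projection is the same as maximising over pairs, because the objective is
  constant along the fibres; so any KKT multiplier completes an optimal point to an optimal pair.
\<close>

lemma mpec_q_global_solution_iff:
  assumes "valid_data d"
  shows "mpec_q_global_solution d (z, \<nu>)
         \<longleftrightarrow> slmfg_q_global_solution d z \<and> \<nu> \<in> kkt_multipliers d z"
  unfolding mpec_q_global_solution_def slmfg_q_global_solution_def is_arg_max_def
    mpec_q_feasible_def slmfg_feasible_iff_kkt[OF assms]
  by auto

theorem theorem2:
  fixes d :: "('i, 'm, 'n) slmfg_data"
  assumes "valid_data d"
  shows
    "(\<forall>z. slmfg_q_global_solution d z \<longrightarrow>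
        (\<forall>\<nu>\<in>kkt_multipliers d z. mpec_q_global_solution d (z, \<nu>)))
     \<and>
     ((\<forall>i\<in>travelers d. par_b d i \<ge> p_min d) \<longrightarrow>
      (\<forall>m\<in>modes d. \<forall>n\<in>tsps d m. par_beta d (m, n) \<le> q_max d) \<longrightarrow>
      (\<forall>z \<nu>. mpec_q_global_solution d (z, \<nu>) \<longrightarrow> slmfg_q_global_solution d z))"
  by (simp add: mpec_q_global_solution_iff[OF assms])

end
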